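(* The following statements about the real field $\mathbb{R}$ are equivalent. (1) [AP & CCC] The conjunction of the Archimedean Principle (AP): for any $x>0$ and any $y>0$, there exists $N\in\mathbb{N}$ such that $N>\frac{x}{y}$; and the Cauchy Convergence Criterion (CCC): every Cauchy sequence is convergent. (2) [MCP] Monotone Convergence Principle: a monotonically increasing sequence that is bounded above is convergent. (3) [AP & strong NIP] The conjunction of AP and the Strong Nested Intervals Principle: if $(I_k)_{k\in\mathbb{N}}$ is a sequence of nested intervals, then $\bigcap_{k=1}^\infty I_k\neq\emptyset$. (4) [AP & weak NIP] The conjunction of AP and the Weak Nested Intervals Principle: if $(I_k)_{k\in\mathbb{N}}$ is a sequence of nested intervals and $\lim_{k\to\infty}\ell(I_k)=0$, then $\bigcap_{k=1}^\infty I_k\neq\emptyset$. (5) [BWP] Bolzano-Weierstrass Property of $\mathbb{R}$: every bounded sequence has a convergent subsequence.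
   Context: The setting is the real field $\mathbb{R}$; any one of the listed principles may be chosen as the completeness axiom for $\mathbb{R}$, and equivalence means that each principle is derived from each other one. $\mathbb{N}=\{1,2,3,\dots\}$. A sequence is a function $\mathbb{N}\to\mathbb{R}$, written $(c_n)_{n\in\mathbb{N}}$. It is monotonically increasing if $c_n\le c_{n+1}$ for all $n$; bounded above if there is $M\in\mathbb{R}$ with $c_n\le M$ for all $n$; bounded if there is $M>0$ with $|c_n|\le M$ for all $n$. It converges to $c\in\mathbb{R}$ if for every $\varepsilon>0$ there is $N\in\mathbb{N}$ such that $|c_n-c|<\varepsilon$ for all $n\ge N$, and it is convergent if it converges to some $c\in\mathbb{R}$. It is a Cauchy sequence if for every $\varepsilon>0$ there is $N\in\mathbb{N}$ such that $|c_m-c_n|<\varepsilon$ for all $m,n\ge N$. A subsequence of $(c_n)$ is a sequence $(c_{N_k})_{k\in\mathbb{N}}$ where $(N_k)_{k\in\mathbb{N}}$ is a strictly increasing sequence of elements of $\mathbb{N}$. A sequence of nested intervals is a sequence $(I_k)_{k\in\mathbb{N}}$ of nonempty closed and bounded intervals $I_k=[a_k,b_k]$ with $I_{k+1}\subseteq I_k$ for all $k$; the length of $I=[a,b]$ is $\ell(I)=b-a$. *)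

theory Defs
  imports Complex_Main
begin

text \<open>
  Over the type \<^typ>\<open>real\<close> every completeness principle is already a theorem, so each one is
  stated as a property of an arbitrary (not necessarily complete or Archimedean) ordered field,
  passed as \<open>TYPE('a)\<close>. Limits are spelled out with epsilons in the field itself because
  \<^class>\<open>linordered_field\<close> carries neither a topology nor a real-valued metric. Sequences are
  indexed by \<^typ>\<open>nat\<close> starting at 0.
\<close>

definition converges_to :: "(nat \<Rightarrow> 'a::linordered_field) \<Rightarrow> 'a \<Rightarrow> bool" where
  "converges_to c l \<longleftrightarrow> (\<forall>\<epsilon>>0. \<exists>N. \<forall>n\<ge>N. \<bar>c n - l\<bar> < \<epsilon>)"

definition convergent_seq :: "(nat \<Rightarrow> 'a::linordered_field) \<Rightarrow> bool" where
  "convergent_seq c \<longleftrightarrow> (\<exists>l. converges_to c l)"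

definition cauchy_seq :: "(nat \<Rightarrow> 'a::linordered_field) \<Rightarrow> bool" where
  "cauchy_seq c \<longleftrightarrow> (\<forall>\<epsilon>>0. \<exists>N. \<forall>m\<ge>N. \<forall>n\<ge>N. \<bar>c m - c n\<bar> < \<epsilon>)"

definition increasing_seq :: "(nat \<Rightarrow> 'a::linordered_field) \<Rightarrow> bool" where
  "increasing_seq c \<longleftrightarrow> (\<forall>n. c n \<le> c (Suc n))"

definition bounded_above_seq :: "(nat \<Rightarrow> 'a::linordered_field) \<Rightarrow> bool" where
  "bounded_above_seq c \<longleftrightarrow> (\<exists>M. \<forall>n. c n \<le> M)"

definition bounded_seq :: "(nat \<Rightarrow> 'a::linordered_field) \<Rightarrow> bool" where
  "bounded_seq c \<longleftrightarrow> (\<exists>M>0. \<forall>n. \<bar>c n\<bar> \<le> M)"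

text \<open>A sequence of nested intervals is given by its sequences of left and right endpoints.\<close>

definition nested_intervals :: "(nat \<Rightarrow> 'a::linordered_field) \<Rightarrow> (nat \<Rightarrow> 'a) \<Rightarrow> bool" where
  "nested_intervals a b \<longleftrightarrow>
     (\<forall>k. {a k..b k} \<noteq> {}) \<and> (\<forall>k. {a (Suc k)..b (Suc k)} \<subseteq> {a k..b k})"

definition AP :: "'a::linordered_field itself \<Rightarrow> bool" where
  "AP _ \<longleftrightarrow> (\<forall>x>0. \<forall>y>0. \<exists>N\<ge>1. of_nat N > x / (y::'a))"

definition CCC :: "'a::linordered_field itself \<Rightarrow> bool" where
  "CCC _ \<longleftrightarrow> (\<forall>c :: nat \<Rightarrow> 'a. cauchy_seq c \<longrightarrow> convergent_seq c)"

definition MCP :: "'a::linordered_field itself \<Rightarrow> bool" where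
  "MCP _ \<longleftrightarrow> (\<forall>c :: nat \<Rightarrow> 'a. increasing_seq c \<and> bounded_above_seq c \<longrightarrow> convergent_seq c)"

definition strong_NIP :: "'a::linordered_field itself \<Rightarrow> bool" where
  "strong_NIP _ \<longleftrightarrow>
     (\<forall>a b :: nat \<Rightarrow> 'a. nested_intervals a b \<longrightarrow> (\<Inter>k. {a k..b k}) \<noteq> {})"

definition weak_NIP :: "'a::linordered_field itself \<Rightarrow> bool" where
  "weak_NIP _ \<longleftrightarrow>
     (\<forall>a b :: nat \<Rightarrow> 'a. nested_intervals a b \<and> converges_to (\<lambda>k. b k - a k) 0
        \<longrightarrow> (\<Inter>k. {a k..b k}) \<noteq> {})"

definition BWP :: "'a::linordered_field itself \<Rightarrow> bool" where
  "BWP _ \<longleftrightarrow>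
     (\<forall>c :: nat \<Rightarrow> 'a. bounded_seq c \<longrightarrow>
        (\<exists>N :: nat \<Rightarrow> nat. strict_mono N \<and> convergent_seq (\<lambda>k. c (N k))))"

end

theory Submission
  imports Defs
begin

text \<open>
  The Monotone Convergence Principle serves as the hub. Four implications form a cycle,
  MCP \<open>\<Longrightarrow>\<close> AP and strong NIP \<open>\<Longrightarrow>\<close> AP and weak NIP \<open>\<Longrightarrow>\<close> AP and CCC \<open>\<Longrightarrow>\<close> MCP,
  and BWP is joined to it by MCP \<open>\<Longrightarrow>\<close> BWP \<open>\<Longrightarrow>\<close> MCP.

  MCP gives AP because the sequence of natural numbers has no limit, hence no upper bound, and
  it gives the strong NIP because the left endpoints converge to a common point.
  The weak NIP gives CCC without any bisection: far-out terms of a Cauchy sequence are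
  centres of nested intervals of radius \<open>3 / 2 ^ k\<close>; AP says that these radii tend to zero,
  and the common point of the intervals is the limit.
  AP and CCC give MCP because an increasing sequence that is not Cauchy
  climbs by a fixed amount infinitely often and so, by AP, passes every bound.
  MCP gives BWP because every sequence in a linear order has a monotone subsequence. Conversely,
  an increasing sequence converges as soon as one of its subsequences does.
\<close>

lemma increasing_seq_mono: "increasing_seq c \<Longrightarrow> m \<le> n \<Longrightarrow> c m \<le> c n"
  unfolding increasing_seq_def by (rule lift_Suc_mono_le) auto

lemma AP_exceeds:
  fixes z :: "'a::linordered_field"
  assumes "AP TYPE('a)"
  shows "\<exists>n. z < of_nat n"
proof (cases "z > 0")
  case True
  then show ?thesis using assms[unfolded AP_def, rule_format, of z 1] by auto
next
  case False
  then have "z < of_nat 1" by (simp add: not_less le_less_trans[OF _ zero_less_one])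
  then show ?thesis by blast
qed

lemma AP_inverse_power2_small:
  fixes e :: "'a::linordered_field"
  assumes "AP TYPE('a)" "e > 0"
  shows "\<exists>k. 1 / 2 ^ k < e"
proof -
  obtain n where "1 / e < of_nat n" using AP_exceeds[OF assms(1)] by blast
  also have "(of_nat n :: 'a) < of_nat (2 ^ n)" by (simp only: of_nat_less_iff less_exp)
  also have "(of_nat (2 ^ n) :: 'a) = 2 ^ n" by simp
  finally have "1 / e < 2 ^ n" .
  then have "1 / 2 ^ n < e" using \<open>e > 0\<close> by (simp add: field_simps)
  then show ?thesis by blast
qed

section \<open>Consequences of monotone convergence\<close>

lemma not_convergent_of_nat: "\<not> convergent_seq (of_nat :: nat \<Rightarrow> 'a::linordered_field)"
proof
  assume "convergent_seq (of_nat :: nat \<Rightarrow> 'a)"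
  then obtain l :: 'a and N where N: "\<And>n. n \<ge> N \<Longrightarrow> \<bar>of_nat n - l\<bar> < 1 / 2"
    unfolding convergent_seq_def converges_to_def by (metis half_gt_zero zero_less_one)
  \<comment> \<open>Consecutive naturals differ by 1, so they cannot both lie within \<open>1 / 2\<close> of \<open>l\<close>.\<close>
  have "\<bar>of_nat N - l\<bar> < 1 / 2" "\<bar>of_nat (Suc N) - l\<bar> < 1 / 2" by (rule N; simp)+
  then show False unfolding of_nat_Suc by linarith
qed

lemma MCP_imp_AP:
  assumes "MCP TYPE('a::linordered_field)"
  shows "AP TYPE('a)"
proof -
  have "increasing_seq (of_nat :: nat \<Rightarrow> 'a)" by (simp add: increasing_seq_def)
  then have "\<not> bounded_above_seq (of_nat :: nat \<Rightarrow> 'a)"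
    using assms not_convergent_of_nat unfolding MCP_def by blast
  then have unbounded: "\<exists>n. z < of_nat n" for z :: 'a
    unfolding bounded_above_seq_def by (meson not_le)
  show ?thesis unfolding AP_def
  proof (intro allI impI)
    fix x y :: 'a assume "x > 0" "y > 0"
    then have "x / y > 0" by simp
    obtain n where n: "x / y < of_nat n" using unbounded by blast
    then have "n \<noteq> 0" using \<open>x / y > 0\<close> by (intro notI) simp
    with n show "\<exists>N\<ge>1. x / y < of_nat N" by (auto intro!: exI[of _ n])
  qed
qed

lemma increasing_limit_ge:
  fixes c :: "nat \<Rightarrow> 'a::linordered_field"
  assumes "increasing_seq c" "converges_to c l"
  shows "c k \<le> l"
proof (rule ccontr)
  assume "\<not> c k \<le> l"
  then have "c k - l > 0" by simp
  then obtain N where "\<And>n. n \<ge> N \<Longrightarrow> \<bar>c n - l\<bar> < c k - l"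
    using assms(2) unfolding converges_to_def by blast
  then have "\<bar>c (max N k) - l\<bar> < c k - l" by simp
  moreover have "c k \<le> c (max N k)" by (rule increasing_seq_mono[OF assms(1)]) simp
  ultimately show False by linarith
qed

lemma limit_le_upper_bound:
  fixes c :: "nat \<Rightarrow> 'a::linordered_field"
  assumes "converges_to c l" "\<And>n. c n \<le> M"
  shows "l \<le> M"
proof (rule ccontr)
  assume "\<not> l \<le> M"
  then have "l - M > 0" by simp
  then obtain N where "\<bar>c N - l\<bar> < l - M"
    using assms(1) unfolding converges_to_def by blast
  with assms(2)[of N] show False by linarith
qed

lemma MCP_imp_strong_NIP:
  assumes "MCP TYPE('a::linordered_field)"
  shows "strong_NIP TYPE('a)"
  unfolding strong_NIP_def
proof (intro allI impI)
  fix a b :: "nat \<Rightarrow> 'a"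
  assume nested: "nested_intervals a b"
  have le: "a k \<le> b k" for k using nested by (simp add: nested_intervals_def)
  have step: "a k \<le> a (Suc k)" "b (Suc k) \<le> b k" for k
    using nested le[of "Suc k"] by (auto simp: nested_intervals_def)
  then have inc: "increasing_seq a" by (simp add: increasing_seq_def)
  have left_le_right: "a m \<le> b n" for m n
  proof -
    have "a m \<le> a (max m n)" by (rule increasing_seq_mono[OF inc]) simp
    also have "\<dots> \<le> b (max m n)" by (rule le)
    also have "\<dots> \<le> b n" by (rule lift_Suc_antimono_le[of b]) (auto simp: step)
    finally show ?thesis .
  qed
  then have "bounded_above_seq a" by (auto simp: bounded_above_seq_def)
  with inc assms obtain l where l: "converges_to a l"
    unfolding MCP_def convergent_seq_def by blast
  have "l \<in> {a k..b k}" for k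
    using increasing_limit_ge[OF inc l] limit_le_upper_bound[OF l left_le_right] by simp
  then show "(\<Inter>k. {a k..b k}) \<noteq> {}" by blast
qed

section \<open>From nested intervals to Cauchy sequences\<close>

text \<open>
  If all terms from index \<open>N k\<close> on lie within \<open>1 / 2 ^ k\<close> of each other, then \<open>c (N k)\<close> and
  \<open>c (N (Suc k))\<close> differ by less than \<open>1 / 2 ^ k + 1 / 2 ^ Suc k\<close>, as both are close to any
  sufficiently late term. This is exactly the difference of the radii \<open>3 / 2 ^ k\<close> and
  \<open>3 / 2 ^ Suc k\<close>, so intervals with these radii around the \<open>c (N k)\<close> are nested even when
  the indices \<open>N k\<close> are not increasing.
\<close>

lemma AP_weak_NIP_imp_CCC:
  assumes ap: "AP TYPE('a::linordered_field)" and nip: "weak_NIP TYPE('a)"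
  shows "CCC TYPE('a)"
  unfolding CCC_def
proof (intro allI impI)
  fix c :: "nat \<Rightarrow> 'a"
  assume "cauchy_seq c"
  then have "\<forall>k. \<exists>N. \<forall>m\<ge>N. \<forall>n\<ge>N. \<bar>c m - c n\<bar> < 1 / 2 ^ k"
    unfolding cauchy_seq_def by simp
  then obtain N where N: "\<And>k m n. m \<ge> N k \<Longrightarrow> n \<ge> N k \<Longrightarrow> \<bar>c m - c n\<bar> < 1 / 2 ^ k"
    by metis
  define r :: "nat \<Rightarrow> 'a" where "r k = 1 / 2 ^ k" for k
  have r_pos: "r k > 0" and r_Suc: "r k = 2 * r (Suc k)" for k by (simp_all add: r_def)
  define a where "a k = c (N k) - 3 * r k" for k
  define b where "b k = c (N k) + 3 * r k" for k
  have "a k \<le> a (Suc k) \<and> b (Suc k) \<le> b k" for k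
  proof -
    define n where "n = max (N k) (N (Suc k))"
    have "\<bar>c (N k) - c n\<bar> < r k" "\<bar>c (N (Suc k)) - c n\<bar> < r (Suc k)"
      unfolding r_def by (rule N; simp add: n_def)+
    then show ?thesis using r_Suc[of k] unfolding a_def b_def by linarith
  qed
  moreover have "a k \<le> b k" for k using r_pos[of k] by (simp add: a_def b_def)
  ultimately have nested: "nested_intervals a b" by (simp add: nested_intervals_def)
  have "converges_to (\<lambda>k. b k - a k) 0"
    unfolding converges_to_def
  proof (intro allI impI)
    fix e :: 'a assume "e > 0"
    then obtain k where "1 / 2 ^ k < e / 6"
      using AP_inverse_power2_small[OF ap, of "e / 6"] by auto
    then have k: "6 * r k < e" by (simp add: r_def field_simps)
    have "\<bar>b n - a n - 0\<bar> < e" if "n \<ge> k" for n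
    proof -
      have "r n \<le> r k" using that by (simp add: r_def field_simps)
      then show ?thesis using k r_pos[of n] by (simp add: a_def b_def)
    qed
    then show "\<exists>K. \<forall>n\<ge>K. \<bar>b n - a n - 0\<bar> < e" by blast
  qed
  with nested nip obtain x where "x \<in> (\<Inter>k. {a k..b k})"
    unfolding weak_NIP_def by blast
  then have x: "a k \<le> x" "x \<le> b k" for k by simp_all
  have "converges_to c x"
    unfolding converges_to_def
  proof (intro allI impI)
    fix e :: 'a assume "e > 0"
    then obtain k where "1 / 2 ^ k < e / 4"
      using AP_inverse_power2_small[OF ap, of "e / 4"] by auto
    then have k: "4 * r k < e" by (simp add: r_def field_simps)
    have "\<bar>c n - x\<bar> < e" if "n \<ge> N k" for n
    proof -
      have "\<bar>c n - c (N k)\<bar> < r k" unfolding r_def using that by (intro N) auto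
      then show ?thesis using x[of k] k unfolding a_def b_def by linarith
    qed
    then show "\<exists>K. \<forall>n\<ge>K. \<bar>c n - x\<bar> < e" by blast
  qed
  then show "convergent_seq c" by (auto simp: convergent_seq_def)
qed

section \<open>From Cauchy sequences to monotone convergence\<close>

lemma AP_bounded_increasing_imp_cauchy:
  fixes c :: "nat \<Rightarrow> 'a::linordered_field"
  assumes ap: "AP TYPE('a)" and inc: "increasing_seq c" and "bounded_above_seq c"
  shows "cauchy_seq c"
proof (rule ccontr)
  obtain M where M: "\<And>n. c n \<le> M" using assms(3) by (auto simp: bounded_above_seq_def)
  assume "\<not> cauchy_seq c"
  then obtain e where e: "e > 0" and gap: "\<And>N. \<exists>m\<ge>N. \<exists>n\<ge>N. e \<le> \<bar>c m - c n\<bar>"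
    unfolding cauchy_seq_def by (meson not_less)
  have climb: "\<exists>m. c N + e \<le> c m" for N
  proof -
    obtain m n where mn: "m \<ge> N" "n \<ge> N" "e \<le> \<bar>c m - c n\<bar>" using gap by blast
    have "c N \<le> c m" "c N \<le> c n" using mn by (auto intro: increasing_seq_mono[OF inc])
    with mn(3) have "c N + e \<le> c m \<or> c N + e \<le> c n" by linarith
    then show ?thesis by blast
  qed
  have climbs: "\<exists>m. c 0 + of_nat k * e \<le> c m" for k
  proof (induction k)
    case 0
    show ?case by auto
  next
    case (Suc k)
    then obtain m where m: "c 0 + of_nat k * e \<le> c m" by blast
    obtain m' where "c m + e \<le> c m'" using climb by blast
    with m have "c 0 + of_nat (Suc k) * e \<le> c m'" by (simp add: algebra_simps)
    then show ?case by blast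
  qed
  obtain k where "(M - c 0) / e < of_nat k" using AP_exceeds[OF ap] by blast
  then have "M < c 0 + of_nat k * e" using e by (simp add: field_simps)
  then show False using climbs[of k] M by (meson le_less_trans not_le order_trans)
qed

lemma AP_CCC_imp_MCP:
  assumes "AP TYPE('a::linordered_field)" "CCC TYPE('a)"
  shows "MCP TYPE('a)"
  using assms AP_bounded_increasing_imp_cauchy unfolding MCP_def CCC_def by blast

section \<open>The Bolzano-Weierstrass property\<close>

lemma converges_to_uminus:
  "converges_to (\<lambda>n. - c n) l \<Longrightarrow> converges_to c (- l)"
proof -
  have "\<bar>c n - (- l)\<bar> = \<bar>- c n - l\<bar>" for n using abs_minus_cancel[of "c n + l"] by simp
  then show "converges_to (\<lambda>n. - c n) l \<Longrightarrow> converges_to c (- l)"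
    unfolding converges_to_def by presburger
qed

lemma MCP_imp_BWP:
  assumes mcp: "MCP TYPE('a::linordered_field)"
  shows "BWP TYPE('a)"
  unfolding BWP_def
proof (intro allI impI)
  fix c :: "nat \<Rightarrow> 'a"
  assume "bounded_seq c"
  then obtain M where "\<And>n. \<bar>c n\<bar> \<le> M" by (auto simp: bounded_seq_def)
  then have M: "c n \<le> M" "- c n \<le> M" for n by (simp_all add: abs_le_iff)
  obtain N where N: "strict_mono N" "monoseq (\<lambda>k. c (N k))"
    using seq_monosub[of c] by blast
  from N(2) have "convergent_seq (\<lambda>k. c (N k))"
    unfolding monoseq_Suc
  proof
    assume "\<forall>n. c (N n) \<le> c (N (Suc n))"
    then have "increasing_seq (\<lambda>k. c (N k))" by (simp add: increasing_seq_def)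
    moreover have "bounded_above_seq (\<lambda>k. c (N k))" using M by (auto simp: bounded_above_seq_def)
    ultimately show ?thesis using mcp by (simp add: MCP_def)
  next
    assume "\<forall>n. c (N (Suc n)) \<le> c (N n)"
    then have "increasing_seq (\<lambda>k. - c (N k))" by (simp add: increasing_seq_def)
    moreover have "bounded_above_seq (\<lambda>k. - c (N k))" using M by (auto simp: bounded_above_seq_def)
    ultimately obtain l where "converges_to (\<lambda>k. - c (N k)) l"
      using mcp unfolding MCP_def convergent_seq_def by blast
    then have "converges_to (\<lambda>k. c (N k)) (- l)" by (rule converges_to_uminus)
    then show ?thesis by (auto simp: convergent_seq_def)
  qed
  with N(1) show "\<exists>N. strict_mono N \<and> convergent_seq (\<lambda>k. c (N k))" by blast
qed

text \<open>
  Each term beyond \<open>c (N K)\<close> is squeezed between \<open>c (N K)\<close> and a later term of the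
  subsequence, and both of these are close to the limit.
\<close>

lemma increasing_converges_to_subseq_limit:
  fixes c :: "nat \<Rightarrow> 'a::linordered_field"
  assumes inc: "increasing_seq c" and N: "strict_mono N" and l: "converges_to (\<lambda>k. c (N k)) l"
  shows "converges_to c l"
  unfolding converges_to_def
proof (intro allI impI)
  fix e :: 'a assume "e > 0"
  then obtain K where K: "\<And>k. k \<ge> K \<Longrightarrow> \<bar>c (N k) - l\<bar> < e"
    using l unfolding converges_to_def by blast
  have "\<bar>c n - l\<bar> < e" if "n \<ge> N K" for n
  proof -
    have "K \<le> n" using that seq_suble[OF N, of K] by linarith
    then have "\<bar>c (N K) - l\<bar> < e" "\<bar>c (N n) - l\<bar> < e" by (simp_all add: K)
    moreover have "c (N K) \<le> c n" "c n \<le> c (N n)"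
      using that seq_suble[OF N, of n] by (auto intro: increasing_seq_mono[OF inc])
    ultimately show ?thesis by linarith
  qed
  then show "\<exists>m. \<forall>n\<ge>m. \<bar>c n - l\<bar> < e" by blast
qed

lemma BWP_imp_MCP:
  assumes bwp: "BWP TYPE('a::linordered_field)"
  shows "MCP TYPE('a)"
  unfolding MCP_def
proof (intro allI impI, elim conjE)
  fix c :: "nat \<Rightarrow> 'a"
  assume inc: "increasing_seq c" and "bounded_above_seq c"
  then obtain M where M: "\<And>n. c n \<le> M" by (auto simp: bounded_above_seq_def)
  \<comment> \<open>The summand 1 makes the bound positive, also for the zero sequence.\<close>
  have "\<bar>c n\<bar> \<le> \<bar>c 0\<bar> + \<bar>M\<bar> + 1" for n
    using M[of n] increasing_seq_mono[OF inc, of 0 n] by linarith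
  moreover have "\<bar>c 0\<bar> + \<bar>M\<bar> + 1 > 0" by linarith
  ultimately have "bounded_seq c" unfolding bounded_seq_def by blast
  then obtain N l where "strict_mono N" "converges_to (\<lambda>k. c (N k)) l"
    using bwp unfolding BWP_def convergent_seq_def by blast
  then show "convergent_seq c"
    using increasing_converges_to_subseq_limit[OF inc] unfolding convergent_seq_def by blast
qed

theorem theorem78:
  shows "(AP TYPE('a::linordered_field) \<and> CCC TYPE('a) \<longleftrightarrow> MCP TYPE('a)) \<and>
         (MCP TYPE('a) \<longleftrightarrow> AP TYPE('a) \<and> strong_NIP TYPE('a)) \<and>
         (AP TYPE('a) \<and> strong_NIP TYPE('a) \<longleftrightarrow> AP TYPE('a) \<and> weak_NIP TYPE('a)) \<and>
         (AP TYPE('a) \<and> weak_NIP TYPE('a) \<longleftrightarrow> BWP TYPE('a))"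
proof -
  have "strong_NIP TYPE('a) \<Longrightarrow> weak_NIP TYPE('a)"
    unfolding strong_NIP_def weak_NIP_def by blast
  then show ?thesis
    using MCP_imp_AP MCP_imp_strong_NIP AP_weak_NIP_imp_CCC AP_CCC_imp_MCP
      MCP_imp_BWP BWP_imp_MCP by blast
qed

end
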